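(* In the noisy-prediction model described in the context (finite $\Omega$, sub-$\sigma$-fields $\mathcal{H}_1,\dots,\mathcal{H}_I$ drawn with probabilities $p_1,\dots,p_I$, noisy predictions $\tilde{X}_j=Q[\mathbb{E}(Y\mid\mathcal{F}_j),\epsilon_j]$, mixture distribution $\tilde{F}=\sum_{i=1}^I p_i\tilde{F}_i$, and statistical functional $T$ with $T(\tilde{F}_i)=\mathbb{E}(Y\mid\mathcal{H}_i)$), consider an aggregator $\mathcal{X}$ of the noisy predictions $\tilde{X}_1,\dots,\tilde{X}_N$ such that $\mathcal{X}\to T(\tilde{F})$ a.s. as $N\to\infty$. Suppose that the following three assumptions hold: (A) $p_i,p_{i'}>0$ and $\mathbb{P}\left[\mathbb{E}(Y\mid\mathcal{H}_i)\neq\mathbb{E}(Y\mid\mathcal{H}_{i'})\right]>0$ for some $i\neq i'$. (B) For $X\sim F$ and $X'\sim F'$: if $\mathbb{P}(X\le t)>\mathbb{P}(X'\le t)$ for all $t\in\operatorname{supp}(X)$, or $\mathbb{P}(X'\ge t)>\mathbb{P}(X\ge t)$ for all $t\in\operatorname{supp}(X')$, then $T(F)<T(F')$. (C) If $x<y$, then $Q(x,\epsilon)<Q(y,\epsilon)$ for all values of $\epsilon$. Then $\mathcal{X}$ converges a.s. to a strict mean of the calibrated predictions $\mathbb{E}(Y\mid\mathcal{H}_i)$ with $p_i>0$, and hence $\mathcal{X}$ is not asymptotically efficient, i.e. it is not the case that $\mathcal{X}\to\mathbb{E}\left[Y\mid\sigma(\mathcal{H}_i:p_i>0)\right]$ 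a.s.
   Context: Setting. $(\Omega,\mathcal{F},\mathbb{P})$ is a probability space with $|\Omega|<\infty$, and $Y$ is a real-valued square-integrable random variable on it (the outcome). $\mathcal{H}_1,\dots,\mathcal{H}_I$ are all the sub-$\sigma$-fields of $\mathcal{F}$ (finitely many). The forecasters' information sets $\mathcal{F}_1,\mathcal{F}_2,\dots$ are i.i.d. draws from $\{\mathcal{H}_1,\dots,\mathcal{H}_I\}$ with $p_i:=\mathbb{P}(\mathcal{F}_j=\mathcal{H}_i)$, $\sum_i p_i=1$. The errors $\epsilon_1,\epsilon_2,\dots$ are i.i.d. The draws $(\mathcal{F}_j)_j$ and $(\epsilon_j)_j$ are independent of each other and of the point $\omega\in\Omega$ (they are carried by an auxiliary probability space; "a.s." refers to the product with $(\Omega,\mathcal{F},\mathbb{P})$). The $j$th noisy prediction is $\tilde{X}_j=Q[\mathbb{E}(Y\mid\mathcal{F}_j),\epsilon_j]$, where $Q(\cdot,\cdot)$ is a deterministic real-valued function that adds error to the calibrated prediction $\mathbb{E}(Y\mid\mathcal{F}_j)$. Distributions. For each $i$, $\tilde{F}_i$ is the cumulative distribution function of $\tilde{X}_j\mid(\mathcal{F}_j=\mathcal{H}_i)$; more precisely, for given $\omega\in\Omega$ it is the CDF of $Q(x,\epsilon)$ with $x=\mathbb{E}(Y\mid\mathcal{H}_i)(\omega)$ and $\epsilon$ distributed as the $\epsilon_j$. Given $\omega$, the $\tilde{X}_j$ are i.i.d. draws from the mixture $\tilde{F}=\sum_{i=1}^I p_i\tilde{F}_i$. Thus $\tilde{F}_i$,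 $\tilde{F}$ and $T(\tilde{F})$ depend on $\omega$. $T(\cdot)$ is a real-valued statistical functional on probability distributions (identified with their CDFs) on $\mathbb{R}$, whose domain includes the distributions occurring here (the distribution of $Q(x,\epsilon)$ for each value $x=\mathbb{E}(Y\mid\mathcal{H}_i)(\omega)$, and their mixtures with weights $p_i$), and which satisfies $T(\tilde{F}_i)=\mathbb{E}(Y\mid\mathcal{H}_i)$ for every $i$. In assumption (B), $F$ and $F'$ range over the distributions in the domain of $T$. For a random variable $X$, $\operatorname{supp}(X)=\{t:\mathbb{P}(X=t)>0\}$. Terminology. An aggregator $\mathcal{X}=\mathcal{X}^{(N)}$ of $\tilde{X}_1,\dots,\tilde{X}_N$ is a $\sigma(\tilde{X}_1,\dots,\tilde{X}_N)$-measurable random variable for each $N$; limits are as $N\to\infty$. Since $\sigma(\mathcal{F}_1,\mathcal{F}_2,\dots)=\sigma(\mathcal{H}_i:p_i>0)$ a.s., $\mathcal{X}$ is called asymptotically efficient if and only if $\mathcal{X}\to\mathbb{E}[Y\mid\sigma(\mathcal{H}_i:p_i>0)]$ a.s. A strict mean of finitely many predictions equals the unanimous prediction whenever all of them agree and, whenever at least two of them disagree, lies strictly between the smallest and the largest of them. *)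

theory Defs
  imports "HOL-Probability.Probability"
begin

definition subfields :: "'a measure \<Rightarrow> 'a set set set" where
  "subfields M = {G. sigma_algebra (space M) G \<and> G \<subseteq> sets M}"

text \<open>
  Conditional expectation of \<open>Y\<close> given the sub-sigma-field generated by a collection \<open>G\<close> of
  events. \<open>real_cond_exp\<close> uses only the space and the measurable sets of its second argument,
  so it does not matter that \<open>sigma\<close> builds the null measure.
\<close>

definition cexp :: "'a measure \<Rightarrow> 'a set set \<Rightarrow> ('a \<Rightarrow> real) \<Rightarrow> 'a \<Rightarrow> real" where
  "cexp M G Y = real_cond_exp M (sigma (space M) G) Y"

text \<open>
  The first component of the sample point is the point of the space \<open>M\<close> carrying the outcome;
  the second one belongs to the auxiliary space that carries the information sets \<open>\<F>\<close> and the
  errors \<open>\<epsilon>\<close>.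
\<close>

definition noisy_prediction ::
  "'a measure \<Rightarrow> ('a \<Rightarrow> real) \<Rightarrow> (real \<Rightarrow> 'e \<Rightarrow> real) \<Rightarrow>
   (nat \<Rightarrow> 'b \<Rightarrow> 'a set set) \<Rightarrow> (nat \<Rightarrow> 'b \<Rightarrow> 'e) \<Rightarrow> nat \<Rightarrow> 'a \<times> 'b \<Rightarrow> real" where
  "noisy_prediction M Y Q \<F> \<epsilon> j = (\<lambda>(\<omega>, b). Q (cexp M (\<F> j b) Y \<omega>) (\<epsilon> j b))"

text \<open>CDF of \<open>Q(x, \<epsilon>)\<close> when the error has law \<open>E\<close>.\<close>

definition noise_cdf :: "'e measure \<Rightarrow> (real \<Rightarrow> 'e \<Rightarrow> real) \<Rightarrow> real \<Rightarrow> real \<Rightarrow> real" where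
  "noise_cdf E Q x = cdf (distr E borel (Q x))"

definition mixture_cdf ::
  "'a measure \<Rightarrow> ('a \<Rightarrow> real) \<Rightarrow> 'e measure \<Rightarrow> (real \<Rightarrow> 'e \<Rightarrow> real) \<Rightarrow>
   nat \<Rightarrow> (nat \<Rightarrow> 'a set set) \<Rightarrow> (nat \<Rightarrow> real) \<Rightarrow> 'a \<Rightarrow> real \<Rightarrow> real" where
  "mixture_cdf M Y E Q n H p \<omega> = (\<lambda>t. \<Sum>i<n. p i * noise_cdf E Q (cexp M (H i) Y \<omega>) t)"

text \<open>The support of a random variable with law \<open>\<mu>\<close> consists of its atoms; it is empty for
  an atomless law.\<close>

definition supp :: "real measure \<Rightarrow> real set" where
  "supp \<mu> = {t. measure \<mu> {t} > 0}"

definition generated_field :: "'c measure \<Rightarrow> (nat \<Rightarrow> 'c \<Rightarrow> real) \<Rightarrow> nat \<Rightarrow> 'c measure" where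
  "generated_field P Xs N =
     sigma (space P) (\<Union>j<N. {Xs j -` B \<inter> space P | B. B \<in> sets borel})"

definition aggregator ::
  "'c measure \<Rightarrow> (nat \<Rightarrow> 'c \<Rightarrow> real) \<Rightarrow> (nat \<Rightarrow> 'c \<Rightarrow> real) \<Rightarrow> bool" where
  "aggregator P Xs X \<longleftrightarrow> (\<forall>N\<ge>1. X N \<in> borel_measurable (generated_field P Xs N))"

definition asymptotically_efficient ::
  "'a measure \<Rightarrow> 'b measure \<Rightarrow> ('a \<Rightarrow> real) \<Rightarrow> nat \<Rightarrow> (nat \<Rightarrow> 'a set set) \<Rightarrow> (nat \<Rightarrow> real) \<Rightarrow>
   (nat \<Rightarrow> 'a \<times> 'b \<Rightarrow> real) \<Rightarrow> bool" where
  "asymptotically_efficient M A Y n H p X \<longleftrightarrow>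
     (AE z in M \<Otimes>\<^sub>M A.
        (\<lambda>N. X N z) \<longlonglongrightarrow> cexp M (\<Union>i\<in>{i. i < n \<and> p i > 0}. H i) Y (fst z))"

definition strict_mean :: "'i set \<Rightarrow> (('i \<Rightarrow> real) \<Rightarrow> real) \<Rightarrow> bool" where
  "strict_mean K m \<longleftrightarrow> (\<forall>x \<in> K \<rightarrow>\<^sub>E UNIV.
     (\<forall>c. (\<forall>i\<in>K. x i = c) \<longrightarrow> m x = c) \<and>
     ((\<exists>i\<in>K. \<exists>j\<in>K. x i \<noteq> x j) \<longrightarrow> Min (x ` K) < m x \<and> m x < Max (x ` K)))"

end

theory Submission
  imports Defs
begin

text \<open>
  Fix \<open>\<omega>\<close> and write \<open>x\<^sub>i\<close> for the calibrated predictions. By (C), strictly raising \<open>x\<close> removes from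
  the event \<open>Q(x, \<epsilon>) \<le> t\<close> at least the event \<open>Q(x, \<epsilon>) = t\<close>, which is not null when \<open>t\<close> is an atom;
  so (B) places \<open>T\<close> of a nondegenerate mixture strictly between the least and the largest \<open>x\<^sub>i\<close>.

  If the limit were the conditional expectation \<open>Z\<close> given all the information, then
  \<open>\<E>(Z | \<H>\<^sub>i) = x\<^sub>i\<close> while \<open>Z < max\<^sub>i x\<^sub>i\<close> wherever some \<open>x\<^sub>i\<close> differs from \<open>Z\<close>. Descending through the
  finitely many values \<open>t\<close> of \<open>Z\<close>: if \<open>x\<^sub>i = Z\<close> on \<open>Z > t\<close>, integrating \<open>x\<^sub>i - Z\<close> over \<open>x\<^sub>i > t\<close> shows
  \<open>x\<^sub>i \<le> t\<close> on \<open>Z = t\<close> for all \<open>i\<close>, hence \<open>x\<^sub>i = Z\<close> there. All the predictions then agree almost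
  surely, against (A).
\<close>

section \<open>Mixtures and dominance between laws of noisy predictions\<close>

text \<open>Only the cdf of the mixture is given. Its limit at infinity yields the total weight; its
  left limits yield the measures of open half-lines and hence, by complement, the upper tails
  compared in the second alternative of (B).\<close>

lemma measure_atLeast_eq_cdf_mixture:
  assumes "real_distribution \<mu>" "\<And>i. i \<in> K \<Longrightarrow> real_distribution (\<nu> i)"
    and cdf: "cdf \<mu> = (\<lambda>t. \<Sum>i\<in>K. p i * cdf (\<nu> i) t)"
  shows "sum p K = 1"
    and "measure \<mu> {t..} = (\<Sum>i\<in>K. p i * measure (\<nu> i) {t..})"
proof -
  interpret \<mu>: real_distribution \<mu> by fact
  have "(cdf \<mu> \<longlongrightarrow> (\<Sum>i\<in>K. p i * 1)) at_top"
    unfolding cdf using assms(2)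
    by (intro tendsto_sum tendsto_mult tendsto_const real_distribution.cdf_lim_at_top_prob)
  then show sum: "sum p K = 1"
    using tendsto_unique[OF _ _ \<mu>.cdf_lim_at_top_prob] by fastforce
  have compl: "measure \<rho> {t..} = 1 - measure \<rho> {..<t}" if "real_distribution \<rho>" for \<rho>
  proof -
    interpret real_distribution \<rho> by fact
    have "space \<rho> - {..<t} = {t..}" by auto
    then show ?thesis using prob_compl[of "{..<t}"] by simp
  qed
  have "(cdf \<mu> \<longlongrightarrow> (\<Sum>i\<in>K. p i * measure (\<nu> i) {..<t})) (at_left t)"
    unfolding cdf using assms(2)
    by (intro tendsto_sum tendsto_mult tendsto_const finite_borel_measure.cdf_at_left)
       (simp add: real_distribution.finite_borel_measure_M)
  then have "measure \<mu> {..<t} = (\<Sum>i\<in>K. p i * measure (\<nu> i) {..<t})"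
    using tendsto_unique[OF _ \<mu>.cdf_at_left] by fastforce
  then show "measure \<mu> {t..} = (\<Sum>i\<in>K. p i * measure (\<nu> i) {t..})"
    using sum by (simp add: compl assms(1,2) right_diff_distrib sum_subtractf)
qed

lemma weighted_mean_less:
  fixes p f :: "'i \<Rightarrow> real"
  assumes "finite K" "\<And>i. i \<in> K \<Longrightarrow> p i > 0" "sum p K = 1"
    and "\<And>i. i \<in> K \<Longrightarrow> f i \<le> c" "k \<in> K" "f k < c"
  shows "(\<Sum>i\<in>K. p i * f i) < c"
proof -
  have "(\<Sum>i\<in>K. p i * f i) < (\<Sum>i\<in>K. p i * c)"
    using assms by (intro sum_strict_mono_ex1) (auto intro!: mult_left_mono less_imp_le)
  then show ?thesis using assms(3) by (simp flip: sum_distrib_right)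
qed

text \<open>Both laws are coupled through one error \<open>e\<close>. The event
  \<open>Q y e \<le> t\<close> lies in \<open>Q x e \<le> t\<close>, and the difference contains
  \<open>Q x e = t\<close>, because there \<open>Q y e > t\<close>. For upper tails the roles are
  exchanged and the gap contains \<open>Q y e = t\<close>. An atom at \<open>t\<close> makes the gap
  non-null.\<close>

lemma (in prob_space) distr_strict_mono_less:
  assumes meas: "\<And>x. Q x \<in> borel_measurable M"
    and mono: "\<And>x y e. e \<in> space M \<Longrightarrow> x < y \<Longrightarrow> Q x e < Q y e"
    and "x < y"
  shows "t \<in> supp (distr M borel (Q x)) \<Longrightarrow>
           measure (distr M borel (Q y)) {..t} < measure (distr M borel (Q x)) {..t::real}"
    and "t \<in> supp (distr M borel (Q y)) \<Longrightarrow>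
           measure (distr M borel (Q x)) {t..} < measure (distr M borel (Q y)) {t..}"
proof -
  note [measurable] = meas
  have strict: "prob B < prob C"
    if "0 < prob {e \<in> space M. Q z e = t}" "B \<in> events" "C \<in> events" "B \<subseteq> C"
      "{e \<in> space M. Q z e = t} \<subseteq> C - B" for z B C
  proof -
    have "prob {e \<in> space M. Q z e = t} \<le> prob (C - B)"
      using that by (intro finite_measure_mono) auto
    then show ?thesis using that by (simp add: finite_measure_Diff)
  qed
  have eq: "measure (distr M borel (Q z)) S = prob {e \<in> space M. Q z e \<in> S}"
    if "S \<in> sets borel" for z S
    using that by (subst measure_distr) (auto simp: vimage_def Int_def conj_commute)
  show "measure (distr M borel (Q y)) {..t} < measure (distr M borel (Q x)) {..t}"
    if "t \<in> supp (distr M borel (Q x))"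
  proof -
    have "prob {e \<in> space M. Q y e \<le> t} < prob {e \<in> space M. Q x e \<le> t}"
      using that by (intro strict[of x]) (auto simp: supp_def eq dest: mono[OF _ \<open>x < y\<close>])
    then show ?thesis by (simp add: eq)
  qed
  show "measure (distr M borel (Q x)) {t..} < measure (distr M borel (Q y)) {t..}"
    if "t \<in> supp (distr M borel (Q y))"
  proof -
    have "prob {e \<in> space M. t \<le> Q x e} < prob {e \<in> space M. t \<le> Q y e}"
      using that by (intro strict[of y]) (auto simp: supp_def eq dest: mono[OF _ \<open>x < y\<close>])
    then show ?thesis by (simp add: eq)
  qed
qed

text \<open>At an atom of an extreme component, no component has a larger tail, and one with a
  different argument has a strictly smaller tail. Disagreement provides such a component, and its
  weight is positive, so averaging keeps the inequality strict. For an atomless extreme component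
  the claim is vacuous, exactly like the matching hypothesis of (B).\<close>

lemma noise_mixture_dominated:
  assumes "prob_space E" and meas: "\<And>x. Q x \<in> borel_measurable E"
    and mono: "\<And>x y e. e \<in> space E \<Longrightarrow> x < y \<Longrightarrow> Q x e < Q y e"
    and K: "finite K" "\<And>i. i \<in> K \<Longrightarrow> p i > 0"
    and \<mu>: "real_distribution \<mu>" "cdf \<mu> = (\<lambda>t. \<Sum>i\<in>K. p i * noise_cdf E Q (x i) t)"
    and disagree: "i \<in> K" "j \<in> K" "x i \<noteq> x j"
  shows "\<forall>t \<in> supp (distr E borel (Q (Min (x ` K)))).
           measure \<mu> {..t} < measure (distr E borel (Q (Min (x ` K)))) {..t}"
    and "\<forall>t \<in> supp (distr E borel (Q (Max (x ` K)))).
           measure \<mu> {t..} < measure (distr E borel (Q (Max (x ` K)))) {t..}"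
proof -
  interpret E: prob_space E by fact
  have dist: "real_distribution (distr E borel (Q z))" for z
    by (intro E.real_distribution_distr meas)
  have cdf: "cdf \<mu> = (\<lambda>t. \<Sum>i\<in>K. p i * cdf (distr E borel (Q (x i))) t)"
    using \<mu>(2) by (simp add: noise_cdf_def)
  note mix = measure_atLeast_eq_cdf_mixture[OF \<mu>(1) dist cdf]
  have lo: "Min (x ` K) \<le> x k" and hi: "x k \<le> Max (x ` K)" if "k \<in> K" for k
    using that K(1) by auto
  have "Min (x ` K) \<noteq> x i \<or> Min (x ` K) \<noteq> x j" using disagree by auto
  then obtain k where k: "k \<in> K" "Min (x ` K) < x k"
    using disagree(1,2) lo by (metis order_le_less)
  have "Max (x ` K) \<noteq> x i \<or> Max (x ` K) \<noteq> x j" using disagree by auto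
  then obtain l where l: "l \<in> K" "x l < Max (x ` K)"
    using disagree(1,2) hi by (metis order_le_less)
  note less = E.distr_strict_mono_less[where Q = Q, OF meas mono]
  show "\<forall>t \<in> supp (distr E borel (Q (Min (x ` K)))).
          measure \<mu> {..t} < measure (distr E borel (Q (Min (x ` K)))) {..t}"
  proof
    fix t assume t: "t \<in> supp (distr E borel (Q (Min (x ` K))))"
    have "measure \<mu> {..t} = (\<Sum>i\<in>K. p i * measure (distr E borel (Q (x i))) {..t})"
      using fun_cong[OF cdf, of t] by (simp add: cdf_def)
    also have "\<dots> < measure (distr E borel (Q (Min (x ` K)))) {..t}"
    proof (rule weighted_mean_less[OF K mix(1) _ k(1)])
      fix i assume "i \<in> K"
      then show "measure (distr E borel (Q (x i))) {..t}
          \<le> measure (distr E borel (Q (Min (x ` K)))) {..t}"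
        using less(1)[of "Min (x ` K)" "x i" t] lo[of i] t
        by (cases "x i = Min (x ` K)") auto
    qed (use less(1)[OF _ _ k(2)] t in auto)
    finally show "measure \<mu> {..t} < measure (distr E borel (Q (Min (x ` K)))) {..t}" .
  qed
  show "\<forall>t \<in> supp (distr E borel (Q (Max (x ` K)))).
          measure \<mu> {t..} < measure (distr E borel (Q (Max (x ` K)))) {t..}"
  proof
    fix t assume t: "t \<in> supp (distr E borel (Q (Max (x ` K))))"
    have "measure \<mu> {t..} = (\<Sum>i\<in>K. p i * measure (distr E borel (Q (x i))) {t..})"
      by (rule mix(2))
    also have "\<dots> < measure (distr E borel (Q (Max (x ` K)))) {t..}"
    proof (rule weighted_mean_less[OF K mix(1) _ l(1)])
      fix i assume "i \<in> K"
      then show "measure (distr E borel (Q (x i))) {t..}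
          \<le> measure (distr E borel (Q (Max (x ` K)))) {t..}"
        using less(2)[of "x i" "Max (x ` K)" t] hi[of i] t
        by (cases "x i = Max (x ` K)") auto
    qed (use less(2)[OF _ _ l(2)] t in auto)
    finally show "measure \<mu> {t..} < measure (distr E borel (Q (Max (x ` K)))) {t..}" .
  qed
qed

section \<open>Conditional expectations that reproduce their variable\<close>

text \<open>Over the \<open>F\<close>-measurable event \<open>B\<close> the integral of
  \<open>?C - Z\<close> vanishes, yet the integrand is nonnegative there: zero where
  \<open>t < Z \<omega>\<close>, by \<open>eq\<close>, and positive where
  \<open>Z \<omega> \<le> t\<close>. So the latter portion of \<open>B\<close> is null.\<close>

lemma (in sigma_finite_subalgebra) real_cond_exp_le_where_le:
  assumes [measurable]: "integrable M Z"
    and eq: "AE \<omega> in M. t < Z \<omega> \<longrightarrow> real_cond_exp M F Z \<omega> = Z \<omega>"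
  shows "AE \<omega> in M. Z \<omega> \<le> t \<longrightarrow> real_cond_exp M F Z \<omega> \<le> t"
proof -
  let ?C = "real_cond_exp M F Z"
  define B where "B = {\<omega> \<in> space F. t < ?C \<omega>}"
  have B: "B \<in> sets F" unfolding B_def by measurable
  then have [measurable]: "B \<in> sets M" using subalg by (auto simp: subalgebra_def)
  have space: "space F = space M" using subalg by (simp add: subalgebra_def)
  have [measurable]: "integrable M ?C" by (rule real_cond_exp_int(1)) fact
  let ?f = "\<lambda>\<omega>. indicator B \<omega> * (?C \<omega> - Z \<omega>)"
  have int: "integrable M (\<lambda>\<omega>. indicator B \<omega> * ?C \<omega>)" "integrable M (\<lambda>\<omega>. indicator B \<omega> * Z \<omega>)"
    using integrable_mult_indicator[of B M ?C] integrable_mult_indicator[of B M Z] assms(1)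
      \<open>integrable M ?C\<close> by auto
  then have "integrable M ?f" by (simp add: right_diff_distrib)
  moreover have "AE \<omega> in M. 0 \<le> ?f \<omega>"
    using eq by eventually_elim (auto simp: B_def indicator_def not_less)
  moreover have "(\<integral>\<omega>. ?f \<omega> \<partial>M) = 0"
    using real_cond_exp_intA[OF assms(1) B] int
    by (simp add: right_diff_distrib set_lebesgue_integral_def)
  ultimately have "AE \<omega> in M. ?f \<omega> = 0"
    using integral_nonneg_eq_0_iff_AE by blast
  then show ?thesis
    using AE_space by eventually_elim (auto simp: B_def indicator_def space split: if_splits)
qed

text \<open>\<open>exceeded\<close> isolates what the strict mean contributes: wherever some
  prediction differs from \<open>Z\<close>, one lies above it. Having finitely many values gives a
  largest bad level and lets the null sets of the levels be united.\<close>

lemma real_cond_exp_eq_self_if_exceeded: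
  assumes "finite K" and F: "\<And>i. i \<in> K \<Longrightarrow> sigma_finite_subalgebra M (F i)"
    and Z: "integrable M Z" "finite (Z ` space M)"
    and exceeded: "AE \<omega> in M. (\<exists>i\<in>K. real_cond_exp M (F i) Z \<omega> \<noteq> Z \<omega>)
                      \<longrightarrow> (\<exists>i\<in>K. Z \<omega> < real_cond_exp M (F i) Z \<omega>)"
  shows "AE \<omega> in M. \<forall>i\<in>K. real_cond_exp M (F i) Z \<omega> = Z \<omega>"
proof -
  let ?C = "\<lambda>i. real_cond_exp M (F i) Z"
  define agree where "agree s \<longleftrightarrow> (AE \<omega> in M. Z \<omega> = s \<longrightarrow> (\<forall>i\<in>K. ?C i \<omega> = Z \<omega>))" for s
  define S where "S = {s \<in> Z ` space M. \<not> agree s}"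
  have "finite S" using Z(2) by (simp add: S_def)
  have "S = {}"
  proof (rule ccontr)
    assume "S \<noteq> {}"
    \<comment> \<open>The highest level at which agreement fails. Agreement above it supplies the
      hypothesis \<open>eq\<close> of the preceding lemma.\<close>
    define t where "t = Max S"
    have "t \<in> S" using \<open>finite S\<close> \<open>S \<noteq> {}\<close> by (simp add: t_def)
    have "agree s" if "s \<in> {s \<in> Z ` space M. t < s}" for s
    proof (rule ccontr)
      assume "\<not> agree s"
      then have "s \<in> S" using that by (auto simp: S_def)
      then have "s \<le> t" using \<open>finite S\<close> by (simp add: t_def)
      then show False using that by simp
    qed
    then have "AE \<omega> in M. \<forall>s\<in>{s \<in> Z ` space M. t < s}. Z \<omega> = s \<longrightarrow> (\<forall>i\<in>K. ?C i \<omega> = Z \<omega>)"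
      using Z(2) by (intro AE_finite_allI) (auto simp: agree_def)
    then have above: "AE \<omega> in M. t < Z \<omega> \<longrightarrow> (\<forall>i\<in>K. ?C i \<omega> = Z \<omega>)"
      using AE_space by eventually_elim auto
    have "AE \<omega> in M. \<forall>i\<in>K. Z \<omega> \<le> t \<longrightarrow> ?C i \<omega> \<le> t"
    proof (rule AE_finite_allI[OF \<open>finite K\<close>])
      fix i assume "i \<in> K"
      then show "AE \<omega> in M. Z \<omega> \<le> t \<longrightarrow> ?C i \<omega> \<le> t"
        using above
        by (intro sigma_finite_subalgebra.real_cond_exp_le_where_le F Z(1)) (auto elim: AE_mp)
    qed
    \<comment> \<open>On \<open>Z \<omega> = t\<close> a disagreement would, by
      \<open>exceeded\<close>, put some \<open>?C i\<close> above \<open>t\<close>, against the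
      bound just shown.\<close>
    then have "agree t"
      unfolding agree_def using exceeded by eventually_elim force
    then show False using \<open>t \<in> S\<close> by (simp add: S_def)
  qed
  then have "AE \<omega> in M. \<forall>s\<in>Z ` space M. Z \<omega> = s \<longrightarrow> (\<forall>i\<in>K. ?C i \<omega> = Z \<omega>)"
    using Z(2) by (intro AE_finite_allI) (auto simp: agree_def S_def)
  then show ?thesis using AE_space by eventually_elim auto
qed

section \<open>The limit of the aggregator and its inefficiency\<close>

theorem corollary4p4:
  fixes M :: "'a measure" and A :: "'b measure" and E :: "'e measure"
    and Y :: "'a \<Rightarrow> real"
    and n :: nat and H :: "nat \<Rightarrow> 'a set set" and p :: "nat \<Rightarrow> real"
    and \<F> :: "nat \<Rightarrow> 'b \<Rightarrow> 'a set set" and \<epsilon> :: "nat \<Rightarrow> 'b \<Rightarrow> 'e"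
    and Q :: "real \<Rightarrow> 'e \<Rightarrow> real"
    and D :: "(real \<Rightarrow> real) set" and T :: "(real \<Rightarrow> real) \<Rightarrow> real"
    and X :: "nat \<Rightarrow> 'a \<times> 'b \<Rightarrow> real"
  assumes "prob_space M" and "finite (space M)"
    and "Y \<in> borel_measurable M" and "integrable M (\<lambda>\<omega>. (Y \<omega>)\<^sup>2)"
    and "bij_betw H {..<n} (subfields M)"
    and "prob_space A" and "prob_space E"
    and "prob_space.indep_vars A (\<lambda>_. count_space (subfields M)) \<F> UNIV"
    and "\<And>i j. i < n \<Longrightarrow> measure A {b \<in> space A. \<F> j b = H i} = p i"
    and "prob_space.indep_vars A (\<lambda>_. E) \<epsilon> UNIV"
    and "\<And>j. distr A E (\<epsilon> j) = E"
    and "prob_space.indep_set A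
           (sets (vimage_algebra (space A) (\<lambda>b j. \<F> j b)
             (Pi\<^sub>M UNIV (\<lambda>_. count_space (subfields M)))))
           (sets (vimage_algebra (space A) (\<lambda>b j. \<epsilon> j b) (Pi\<^sub>M UNIV (\<lambda>_. E))))"
    and "\<And>x. Q x \<in> borel_measurable E"
    and "D \<subseteq> cdf ` {\<mu>. real_distribution \<mu>}"
    and "\<And>i. i < n \<Longrightarrow> AE \<omega> in M. noise_cdf E Q (cexp M (H i) Y \<omega>) \<in> D"
    and "AE \<omega> in M. mixture_cdf M Y E Q n H p \<omega> \<in> D"
    and "\<And>i. i < n \<Longrightarrow>
           AE \<omega> in M. T (noise_cdf E Q (cexp M (H i) Y \<omega>)) = cexp M (H i) Y \<omega>"
    and "aggregator (M \<Otimes>\<^sub>M A) (noisy_prediction M Y Q \<F> \<epsilon>) X"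
    and "AE z in M \<Otimes>\<^sub>M A. (\<lambda>N. X N z) \<longlonglongrightarrow> T (mixture_cdf M Y E Q n H p (fst z))"
    and A: "\<exists>i<n. \<exists>i'<n. i \<noteq> i' \<and> p i > 0 \<and> p i' > 0 \<and>
           measure M {\<omega> \<in> space M. cexp M (H i) Y \<omega> \<noteq> cexp M (H i') Y \<omega>} > 0"
    and B: "\<And>\<mu> \<mu>'. \<lbrakk>real_distribution \<mu>; real_distribution \<mu>'; cdf \<mu> \<in> D; cdf \<mu>' \<in> D;
           (\<forall>t \<in> supp \<mu>. measure \<mu> {..t} > measure \<mu>' {..t}) \<or>
           (\<forall>t \<in> supp \<mu>'. measure \<mu>' {t..} > measure \<mu> {t..})\<rbrakk>
           \<Longrightarrow> T (cdf \<mu>) < T (cdf \<mu>')"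
    and C: "\<And>x y e. \<lbrakk>e \<in> space E; x < y\<rbrakk> \<Longrightarrow> Q x e < Q y e"
  shows "(\<exists>m. strict_mean {i. i < n \<and> p i > 0} m \<and>
            (AE z in M \<Otimes>\<^sub>M A.
               (\<lambda>N. X N z) \<longlonglongrightarrow> m (\<lambda>i \<in> {i. i < n \<and> p i > 0}. cexp M (H i) Y (fst z))))
         \<and> \<not> asymptotically_efficient M A Y n H p X"
proof -
  interpret M: prob_space M by fact
  interpret A: prob_space A by fact
  interpret E: prob_space E by fact
  interpret pair_sigma_finite M A ..
  define K where "K = {i. i < n \<and> p i > 0}"
  define x where "x \<omega> = (\<lambda>i\<in>K. cexp M (H i) Y \<omega>)" for \<omega>
  \<comment> \<open>The mixture is expressed through the vector of predictions alone, so that one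
    function \<open>m\<close>, independent of \<omega>, can describe the limit.\<close>
  define mix where "mix v = (\<lambda>t. \<Sum>i\<in>K. p i * noise_cdf E Q (v i) t)" for v
  \<comment> \<open>The midpoint is a placeholder for arguments that are not attained by the predictions, where
    \<open>T\<close> is unconstrained, and gives the common value when all predictions agree.\<close>
  define m where "m v =
    (if Min (v ` K) < T (mix v) \<and> T (mix v) < Max (v ` K) then T (mix v)
     else (Min (v ` K) + Max (v ` K)) / 2)" for v
  have K: "finite K" "\<And>i. i \<in> K \<Longrightarrow> p i > 0" "\<And>i. i \<in> K \<Longrightarrow> i < n"
    by (auto simp: K_def)
  obtain a b where ab: "a \<in> K" "b \<in> K"
    "measure M {\<omega> \<in> space M. cexp M (H a) Y \<omega> \<noteq> cexp M (H b) Y \<omega>} > 0"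
    using A by (auto simp: K_def)
  have p_nonneg: "0 \<le> p i" if "i < n" for i
    using assms(9)[OF that] by (metis measure_nonneg)
  have mean: "strict_mean K m"
    unfolding strict_mean_def
  proof (intro ballI conjI allI impI)
    fix v :: "nat \<Rightarrow> real" and c
    assume "\<forall>i\<in>K. v i = c"
    then have "v ` K = {c}" using ab(1) by auto
    then show "m v = c" by (simp add: m_def)
  next
    fix v :: "nat \<Rightarrow> real"
    assume "\<exists>i\<in>K. \<exists>j\<in>K. v i \<noteq> v j"
    then obtain i j where ij: "i \<in> K" "j \<in> K" "v i < v j" by (metis linorder_neqE)
    then have "Min (v ` K) \<le> v i" "v j \<le> Max (v ` K)" using K(1) by auto
    then have "Min (v ` K) < Max (v ` K)" using ij(3) by linarith
    then show "Min (v ` K) < m v" "m v < Max (v ` K)" by (auto simp: m_def)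
  qed
  have mixture: "mixture_cdf M Y E Q n H p \<omega> = mix (x \<omega>)" for \<omega>
  proof
    fix t
    have "(\<Sum>i<n. p i * noise_cdf E Q (cexp M (H i) Y \<omega>) t)
        = (\<Sum>i\<in>K. p i * noise_cdf E Q (cexp M (H i) Y \<omega>) t)"
      by (rule sum.mono_neutral_right) (auto simp: K_def dest: p_nonneg)
    then show "mixture_cdf M Y E Q n H p \<omega> t = mix (x \<omega>) t"
      by (simp add: mixture_cdf_def mix_def x_def)
  qed
  have m_eq: "T (mix (x \<omega>)) = m (x \<omega>)"
    if noise: "\<And>i. i \<in> K \<Longrightarrow> noise_cdf E Q (x \<omega> i) \<in> D"
      and T: "\<And>i. i \<in> K \<Longrightarrow> T (noise_cdf E Q (x \<omega> i)) = x \<omega> i"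
      and mixD: "mix (x \<omega>) \<in> D" for \<omega>
  proof -
    \<comment> \<open>(B) speaks of laws, so a law with the mixture as its cdf is taken from the
      description of \<open>D\<close>.\<close>
    obtain \<mu> where \<mu>: "real_distribution \<mu>" "cdf \<mu> = mix (x \<omega>)"
      using mixD assms(14) by auto
    have dist: "real_distribution (distr E borel (Q z))" for z
      by (intro E.real_distribution_distr assms(13))
    show ?thesis
    proof (cases "\<exists>i\<in>K. \<exists>j\<in>K. x \<omega> i \<noteq> x \<omega> j")
      case True
      then obtain i j where ij: "i \<in> K" "j \<in> K" "x \<omega> i \<noteq> x \<omega> j" by auto
      note dom = noise_mixture_dominated[OF assms(7,13) C K(1,2) \<mu>(1) _ ij,
          OF _ _ _ \<mu>(2)[unfolded mix_def]]
      have "Min (x \<omega> ` K) \<in> x \<omega> ` K" "Max (x \<omega> ` K) \<in> x \<omega> ` K"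
        using ij(1) K(1) by (auto intro: Min_in Max_in)
      then obtain k l where k: "k \<in> K" "Min (x \<omega> ` K) = x \<omega> k"
        and l: "l \<in> K" "Max (x \<omega> ` K) = x \<omega> l" by blast
      \<comment> \<open>The lowest component against the mixture uses the first alternative of (B);
        the mixture against the highest component uses the second.\<close>
      have "T (noise_cdf E Q (x \<omega> k)) < T (cdf \<mu>)"
        unfolding noise_cdf_def
        using dom(1) k noise[OF k(1)] mixD \<mu> dist by (intro B) (auto simp: noise_cdf_def)
      moreover have "T (cdf \<mu>) < T (noise_cdf E Q (x \<omega> l))"
        unfolding noise_cdf_def
        using dom(2) l noise[OF l(1)] mixD \<mu> dist by (intro B) (auto simp: noise_cdf_def)
      ultimately show ?thesis
        using T[OF k(1)] T[OF l(1)] k(2) l(2) \<mu>(2) by (simp add: m_def)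
    next
      case False
      then have const: "\<forall>i\<in>K. x \<omega> i = x \<omega> a" using ab(1) by blast
      \<comment> \<open>The total weight is read off from the mixture being a probability law; a
        unanimous mixture then is its single component.\<close>
      have "sum p K = 1"
        using measure_atLeast_eq_cdf_mixture(1)[OF \<mu>(1) dist \<mu>(2)[unfolded mix_def noise_cdf_def]] .
      then have "mix (x \<omega>) = noise_cdf E Q (x \<omega> a)"
        using const by (simp add: mix_def fun_eq_iff flip: sum_distrib_right)
      moreover have "x \<omega> \<in> K \<rightarrow>\<^sub>E UNIV" by (simp add: x_def)
      then have "m (x \<omega>) = x \<omega> a"
        using mean const unfolding strict_mean_def by blast
      ultimately show ?thesis using T[OF ab(1)] by simp
    qed
  qed
  have "AE \<omega> in M. \<forall>i\<in>K. noise_cdf E Q (cexp M (H i) Y \<omega>) \<in> D"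
    "AE \<omega> in M. \<forall>i\<in>K. T (noise_cdf E Q (cexp M (H i) Y \<omega>)) = cexp M (H i) Y \<omega>"
    using K(1) by (auto intro!: AE_finite_allI assms(15,17) K(3))
  then have "AE \<omega> in M. T (mix (x \<omega>)) = m (x \<omega>)"
    using assms(16)
  proof eventually_elim
    case (elim \<omega>)
    then show ?case by (intro m_eq) (auto simp: mixture x_def)
  qed
  \<comment> \<open>The first marginal of the product is \<open>M\<close>, which carries the null
    set over to the product space.\<close>
  then have "AE \<omega> in distr (M \<Otimes>\<^sub>M A) M fst. T (mix (x \<omega>)) = m (x \<omega>)"
    by (simp only: A.distr_pair_fst)
  then have "AE z in M \<Otimes>\<^sub>M A. T (mix (x (fst z))) = m (x (fst z))"
    by (rule AE_distrD[OF measurable_fst])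
  then have lim: "AE z in M \<Otimes>\<^sub>M A. (\<lambda>N. X N z) \<longlonglongrightarrow> m (x (fst z))"
    using assms(19) by eventually_elim (simp add: mixture)
  have "\<not> asymptotically_efficient M A Y n H p X"
  proof
    define G where "G = sigma (space M) (\<Union>i\<in>K. H i)"
    define F where "F i = sigma (space M) (H i)" for i
    define Z where "Z = real_cond_exp M G Y"
    let ?C = "\<lambda>i. cexp M (H i) Y"
    assume "asymptotically_efficient M A Y n H p X"
    then have "AE z in M \<Otimes>\<^sub>M A. (\<lambda>N. X N z) \<longlonglongrightarrow> Z (fst z)"
      by (simp add: asymptotically_efficient_def Z_def G_def cexp_def K_def)
    then have "AE z in M \<Otimes>\<^sub>M A. Z (fst z) = m (x (fst z))"
      using lim by eventually_elim (rule LIMSEQ_unique)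
    \<comment> \<open>The identity does not involve the auxiliary coordinate, so it descends from
      the product to \<open>M\<close>.\<close>
    then have Z_mean: "AE \<omega> in M. Z \<omega> = m (x \<omega>)"
      using AE_pair by fastforce
    have H: "H i \<subseteq> sets M" if "i \<in> K" for i
      using assms(5) K(3)[OF that] by (auto simp: bij_betw_def subfields_def)
    have H_Pow: "H i \<subseteq> Pow (space M)" if "i \<in> K" for i
      using H[OF that] sets.space_closed by blast
    have UN_Pow: "(\<Union>i\<in>K. H i) \<subseteq> Pow (space M)" using H_Pow by blast
    have "sigma_sets (space M) (\<Union>i\<in>K. H i) \<subseteq> sets M"
      using H by (intro sets.sigma_sets_subset) blast
    then have subG: "subalgebra M G"
      by (simp add: subalgebra_def G_def UN_Pow)
    have subF: "subalgebra G (F i)" if "i \<in> K" for i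
    proof -
      have "sigma_sets (space M) (H i) \<subseteq> sigma_sets (space M) (\<Union>i\<in>K. H i)"
        using that by (intro sigma_sets_mono') blast
      then show ?thesis
        by (simp add: subalgebra_def G_def F_def UN_Pow H_Pow[OF that])
    qed
    have subMF: "subalgebra M (F i)" if "i \<in> K" for i
      using subG subF[OF that] by (auto simp: subalgebra_def)
    have sf: "sigma_finite_subalgebra M N" if "subalgebra M N" for N
      using that
      by (intro finite_measure_subalgebra_is_sigma_finite)
         (simp add: finite_measure_subalgebra_def finite_measure_subalgebra_axioms_def
           M.finite_measure_axioms)
    have Y: "integrable M Y"
      by (rule M.square_integrable_imp_integrable) fact+
    have Z_int: "integrable M Z"
      unfolding Z_def using sf[OF subG] Y by (rule sigma_finite_subalgebra.real_cond_exp_int(1))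
    \<comment> \<open>Each \<open>F i\<close> is coarser than \<open>G\<close>, so the calibrated
      predictions are conditional expectations of \<open>Z\<close> itself, and \<open>Y\<close> can
      be left behind.\<close>
    have tower: "AE \<omega> in M. \<forall>i\<in>K. real_cond_exp M (F i) Z \<omega> = ?C i \<omega>"
    proof (rule AE_finite_allI[OF K(1)])
      fix i assume "i \<in> K"
      then show "AE \<omega> in M. real_cond_exp M (F i) Z \<omega> = ?C i \<omega>"
        unfolding Z_def cexp_def F_def[symmetric]
        using sf[OF subMF] subG subF Y
        by (intro sigma_finite_subalgebra.real_cond_exp_nested_subalg)
    qed
    have "AE \<omega> in M. \<forall>i\<in>K. real_cond_exp M (F i) Z \<omega> = Z \<omega>"
    proof (rule real_cond_exp_eq_self_if_exceeded[OF K(1) sf[OF subMF] Z_int])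
      show "finite (Z ` space M)" using assms(2) by simp
      show "AE \<omega> in M. (\<exists>i\<in>K. real_cond_exp M (F i) Z \<omega> \<noteq> Z \<omega>)
              \<longrightarrow> (\<exists>i\<in>K. Z \<omega> < real_cond_exp M (F i) Z \<omega>)"
        using tower Z_mean
      proof eventually_elim
        case (elim \<omega>)
        have C_eq: "real_cond_exp M (F i) Z \<omega> = x \<omega> i" if "i \<in> K" for i
          using elim(1) that by (simp add: x_def)
        have x: "x \<omega> \<in> K \<rightarrow>\<^sub>E UNIV" by (simp add: x_def)
        show ?case
        proof
          assume "\<exists>i\<in>K. real_cond_exp M (F i) Z \<omega> \<noteq> Z \<omega>"
          \<comment> \<open>Unanimous predictions would equal their mean. Hence a prediction
            different from \<open>m (x \<omega>)\<close> forces disagreement, and the largest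
            prediction then exceeds the mean.\<close>
          then obtain i where i: "i \<in> K" "x \<omega> i \<noteq> m (x \<omega>)" using C_eq elim(2) by auto
          then have "\<exists>i\<in>K. \<exists>j\<in>K. x \<omega> i \<noteq> x \<omega> j"
            using mean x unfolding strict_mean_def by metis
          then have "m (x \<omega>) < Max (x \<omega> ` K)"
            using mean x unfolding strict_mean_def by metis
          moreover have "Max (x \<omega> ` K) \<in> x \<omega> ` K"
            using i(1) K(1) by (intro Max_in) auto
          ultimately obtain k where "k \<in> K" "m (x \<omega>) < x \<omega> k" by auto
          then show "\<exists>i\<in>K. Z \<omega> < real_cond_exp M (F i) Z \<omega>"
            using C_eq elim(2) by auto
        qed
      qed
    qed
    then have "AE \<omega> in M. \<not> ?C a \<omega> \<noteq> ?C b \<omega>"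
      using tower by eventually_elim (use ab(1,2) in auto)
    then have "measure M {\<omega> \<in> space M. ?C a \<omega> \<noteq> ?C b \<omega>} = 0"
      by (subst M.prob_eq_0) (auto simp: cexp_def)
    then show False using ab(3) by simp
  qed
  then show ?thesis
    using mean lim unfolding x_def K_def by blast
qed

end
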